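(* Let $R$ be a finite commutative ring with nonzero identity which is not a field, and let $n>1$ be an integer. Then $\gamma(TD(R,n))\leq |R\setminus U(R)|+|R|-2$.
   Context: $U(R)$ denotes the set of invertible elements of $R$. For a commutative ring $R$ with nonzero identity and an integer $n\ge1$, $TD(R,n)$ is the simple graph with vertex set $R^n\setminus\{(0,\ldots,0)\}$ in which two distinct vertices $\mathbf{x},\mathbf{y}$ are adjacent if and only if $\mathbf{x}\cdot\mathbf{y}=\sum_{i=1}^n x_iy_i=0$ in $R$. A set $D$ of vertices of a graph $G$ is dominating if every vertex of $V(G)\setminus D$ is adjacent to a vertex of $D$; the domination number $\gamma(G)$ is the minimum number of vertices of a dominating set of $G$. *)

theory Defs
  imports "HOL-Algebra.Algebra" "Graph_Theory.Pair_Digraph"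
begin

definition dominating :: "'v pair_pre_digraph \<Rightarrow> 'v set \<Rightarrow> bool" where
  "dominating G D \<longleftrightarrow> D \<subseteq> pverts G \<and> (\<forall>v \<in> pverts G - D. \<exists>u \<in> D. (v, u) \<in> parcs G)"

(* Only meaningful for graphs that have a finite dominating set, in particular for finite
   graphs. The finiteness condition is needed because infinite sets have cardinality 0. *)
definition domination_number :: "'v pair_pre_digraph \<Rightarrow> nat" where
  "domination_number G = (LEAST k. \<exists>D. dominating G D \<and> finite D \<and> card D = k)"

(* The elements of R^n are the extensional functions from {1..n} to the carrier of R. *)
definition vectors :: "('a, 'm) ring_scheme \<Rightarrow> nat \<Rightarrow> (nat \<Rightarrow> 'a) set" where
  "vectors R n = {1..n} \<rightarrow>\<^sub>E carrier R"

definition zero_vector :: "('a, 'm) ring_scheme \<Rightarrow> nat \<Rightarrow> nat \<Rightarrow> 'a" where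
  "zero_vector R n = (\<lambda>i \<in> {1..n}. \<zero>\<^bsub>R\<^esub>)"

definition dot_product ::
    "('a, 'm) ring_scheme \<Rightarrow> nat \<Rightarrow> (nat \<Rightarrow> 'a) \<Rightarrow> (nat \<Rightarrow> 'a) \<Rightarrow> 'a" where
  "dot_product R n x y = (\<Oplus>\<^bsub>R\<^esub> i \<in> {1..n}. x i \<otimes>\<^bsub>R\<^esub> y i)"

(* As usual in this graph library, an undirected edge is a pair of opposite arcs. *)
definition TD :: "('a, 'm) ring_scheme \<Rightarrow> nat \<Rightarrow> (nat \<Rightarrow> 'a) pair_pre_digraph" where
  "TD R n =
     (let V = vectors R n - {zero_vector R n}
      in \<lparr> pverts = V,
           parcs = {(x, y). x \<in> V \<and> y \<in> V \<and> x \<noteq> y \<and> dot_product R n x y = \<zero>\<^bsub>R\<^esub>} \<rparr>)"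

lemma dot_product_commute:
  assumes "cring R" "x \<in> vectors R n" "y \<in> vectors R n"
  shows "dot_product R n x y = dot_product R n y x"
proof -
  interpret cring R by fact
  show ?thesis
    unfolding dot_product_def
    by (rule finsum_cong') (use assms in \<open>auto simp: vectors_def m_comm PiE_iff Pi_iff\<close>)
qed

lemma pair_graph_TD:
  assumes "cring R" "finite (carrier R)"
  shows "pair_graph (TD R n)"
proof -
  have fin: "finite (pverts (TD R n))"
    using assms(2) by (simp add: TD_def Let_def vectors_def finite_PiE)
  moreover have "parcs (TD R n) \<subseteq> pverts (TD R n) \<times> pverts (TD R n)"
    by (auto simp: TD_def Let_def)
  ultimately have "finite (parcs (TD R n))"
    by (meson finite_SigmaI finite_subset)
  with fin show ?thesis
    by unfold_locales
       (auto simp: TD_def Let_def symmetric_def sym_def dot_product_commute[OF assms(1)])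
qed

end

theory Submission
  imports Defs
begin

text \<open>
  The bound comes from a dominating set whose vectors are supported on the first two coordinates.
  Among the nonzero nonunits of \<open>R\<close>, which exist because \<open>R\<close> is not a field, take \<open>s\<close> whose principal
  ideal \<open>I = s R\<close> has the fewest elements. Then \<open>I\<close> is generated by each of its nonzero elements.
  Let \<open>D\<close> consist of \<open>(s, 0, 0, \<dots>, 0)\<close> and of all \<open>(t, s, 0, \<dots>, 0)\<close> with \<open>t \<in> I\<close>.

  Given a vector \<open>x\<close> with first coordinates \<open>a\<close> and \<open>b\<close>, either \<open>a s = 0\<close>, and \<open>x\<close> is orthogonal to
  \<open>(s, 0, \<dots>)\<close>, or \<open>a s\<close> is a nonzero element of \<open>I\<close> and so generates \<open>I\<close>. In the second case
  \<open>b s = c a s\<close> for some \<open>c\<close>, and \<open>x\<close> is orthogonal to \<open>(- c s, s, \<dots>)\<close>. Hence \<open>D\<close> is dominating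
  (lemma \<open>dominating_minimal_ideal\<close>). Conceptually, \<open>D\<close> is \<open>s\<close> times the projective line over the
  residue field \<open>R / ann(s)\<close>.

  The ideal \<open>I\<close> is proper, so \<open>D\<close> has at most \<open>|I| + 1 \<le> |R|\<close> elements. As \<open>0\<close> and \<open>s\<close> are two distinct
  nonunits, \<open>|R|\<close> is at most \<open>|R - U(R)| + |R| - 2\<close>.
\<close>

definition two_coordinate_vector :: "('a, 'm) ring_scheme \<Rightarrow> nat \<Rightarrow> 'a \<Rightarrow> 'a \<Rightarrow> nat \<Rightarrow> 'a" where
  "two_coordinate_vector R n u v =
     (\<lambda>i \<in> {1..n}. if i = 1 then u else if i = 2 then v else \<zero>\<^bsub>R\<^esub>)"

lemma domination_number_le_card:
  assumes "dominating G D" "finite D"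
  shows "domination_number G \<le> card D"
  unfolding domination_number_def using assms by (intro Least_le) blast

lemma dominating_TD_I:
  assumes "D \<subseteq> vectors R n - {zero_vector R n}"
    and "\<And>x. x \<in> vectors R n \<Longrightarrow> \<exists>y \<in> D. dot_product R n x y = \<zero>\<^bsub>R\<^esub>"
  shows "dominating (TD R n) D"
  using assms unfolding dominating_def TD_def Let_def by fastforce

context cring
begin

lemma two_coordinate_vector_in_vectors:
  assumes "u \<in> carrier R" "v \<in> carrier R"
  shows "two_coordinate_vector R n u v \<in> vectors R n"
  using assms by (auto simp: two_coordinate_vector_def vectors_def)

lemma two_coordinate_vector_nonzero:
  assumes "n > 1" "u \<noteq> \<zero> \<or> v \<noteq> \<zero>"
  shows "two_coordinate_vector R n u v \<noteq> zero_vector R n"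
proof
  assume eq: "two_coordinate_vector R n u v = zero_vector R n"
  show False
    using assms fun_cong[OF eq, of 1] fun_cong[OF eq, of 2]
    by (auto simp: two_coordinate_vector_def zero_vector_def)
qed

lemma dot_product_two_coordinate_vector:
  assumes "n > 1" "x \<in> vectors R n" "u \<in> carrier R" "v \<in> carrier R"
  shows "dot_product R n x (two_coordinate_vector R n u v) = x 1 \<otimes> u \<oplus> x 2 \<otimes> v"
proof -
  let ?f = "\<lambda>i. x i \<otimes> two_coordinate_vector R n u v i"
  have x: "x i \<in> carrier R" if "i \<in> {1..n}" for i
    using assms(2) that by (auto simp: vectors_def)
  have split: "{1..n} = insert 1 (insert 2 {3..n})"
    using assms(1) by auto
  have tail: "(\<Oplus>i \<in> {3..n}. ?f i) = \<zero>"
    using x by (intro add.finprod_one_eqI) (auto simp: two_coordinate_vector_def)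
  have closed: "?f \<in> {3..n} \<rightarrow> carrier R" "?f 1 \<in> carrier R" "?f 2 \<in> carrier R"
    using assms x by (auto simp: two_coordinate_vector_def)
  have "dot_product R n x (two_coordinate_vector R n u v) = ?f 1 \<oplus> (?f 2 \<oplus> (\<Oplus>i \<in> {3..n}. ?f i))"
    unfolding dot_product_def split using closed by (subst finsum_insert; auto)+
  also have "\<dots> = x 1 \<otimes> u \<oplus> x 2 \<otimes> v"
    using assms x tail by (simp add: two_coordinate_vector_def)
  finally show ?thesis .
qed

text \<open>
  The minimality condition makes \<open>s\<close> behave like a unit of a field: unless \<open>a s = 0\<close>, every element
  of the ideal is a multiple of \<open>a s\<close>, so \<open>a t + b s = 0\<close> has a solution \<open>t\<close> in the ideal.
\<close>
lemma dominating_minimal_ideal: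
  assumes n: "n > 1" and s: "s \<in> carrier R" "s \<noteq> \<zero>"
    and minimal: "\<And>t. t \<in> PIdl s \<Longrightarrow> t \<noteq> \<zero> \<Longrightarrow> PIdl t = PIdl s"
  shows "dominating (TD R n)
           (insert (two_coordinate_vector R n s \<zero>)
                   ((\<lambda>t. two_coordinate_vector R n t s) ` (PIdl s)))"
    (is "dominating _ ?D")
proof (rule dominating_TD_I)
  have ideal_closed: "t \<in> carrier R" if "t \<in> PIdl s" for t
    using that s by (auto simp: cgenideal_def)
  then show "?D \<subseteq> vectors R n - {zero_vector R n}"
    using n s by (auto simp: two_coordinate_vector_in_vectors two_coordinate_vector_nonzero)
  fix x assume x: "x \<in> vectors R n"
  then have x12: "x 1 \<in> carrier R" "x 2 \<in> carrier R"
    using n by (auto simp: vectors_def)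
  show "\<exists>y \<in> ?D. dot_product R n x y = \<zero>"
  proof (cases "x 1 \<otimes> s = \<zero>")
    case True
    then have "dot_product R n x (two_coordinate_vector R n s \<zero>) = \<zero>"
      using n s x x12 by (simp add: dot_product_two_coordinate_vector)
    then show ?thesis by blast
  next
    case False
    have "x 1 \<otimes> s \<in> PIdl s" "x 2 \<otimes> s \<in> PIdl s"
      using x12 by (auto simp: cgenideal_def)
    with minimal False have "x 2 \<otimes> s \<in> PIdl (x 1 \<otimes> s)"
      by simp
    then obtain c where c: "c \<in> carrier R" "x 2 \<otimes> s = c \<otimes> (x 1 \<otimes> s)"
      by (auto simp: cgenideal_def)
    define t where "t = (\<ominus> c) \<otimes> s"
    have t: "t \<in> PIdl s"
      using c(1) unfolding t_def cgenideal_def by blast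
    have "x 1 \<otimes> t \<oplus> x 2 \<otimes> s = \<zero>"
      unfolding c(2) t_def using c(1) s x12 by algebra
    then have "dot_product R n x (two_coordinate_vector R n t s) = \<zero>"
      using n s x ideal_closed[OF t] by (simp add: dot_product_two_coordinate_vector)
    with t show ?thesis by blast
  qed
qed

text \<open>
  Minimality is imposed only among principal ideals of nonzero nonunits. This loses nothing, since
  every multiple of a nonunit is again a nonunit.
\<close>
lemma exists_nonunit_generating_minimal_ideal:
  assumes fin: "finite (carrier R)" and nontrivial: "\<one> \<noteq> \<zero>" and nonfield: "\<not> field R"
  obtains s where "s \<in> carrier R" "s \<noteq> \<zero>" "s \<notin> Units R"
    "\<And>t. t \<in> PIdl s \<Longrightarrow> t \<noteq> \<zero> \<Longrightarrow> PIdl t = PIdl s"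
proof -
  let ?P = "\<lambda>s. s \<in> carrier R \<and> s \<noteq> \<zero> \<and> s \<notin> Units R"
  have "\<zero> \<notin> Units R"
    using nontrivial by (auto simp: Units_def)
  then obtain s\<^sub>0 where "?P s\<^sub>0"
    using nonfield cring_fieldI Units_closed by blast
  from ex_has_least_nat[of ?P, OF this, of "\<lambda>s. card (PIdl s)"]
  obtain s where s: "?P s" and least: "\<And>t. ?P t \<Longrightarrow> card (PIdl s) \<le> card (PIdl t)"
    by blast
  have "PIdl t = PIdl s" if t: "t \<in> PIdl s" "t \<noteq> \<zero>" for t
  proof (rule card_seteq)
    show sub: "PIdl t \<subseteq> PIdl s"
      using s t(1) by (intro cgenideal_minimal cgenideal_ideal) auto
    show "finite (PIdl s)"
      using s by (intro finite_subset[OF _ fin]) (auto simp: cgenideal_def)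
    obtain r where r: "r \<in> carrier R" "t = r \<otimes> s"
      using t(1) by (auto simp: cgenideal_def)
    then have "t \<notin> Units R"
      using s prod_unit_r unit_factor m_comm by metis
    with least r s t(2) show "card (PIdl s) \<le> card (PIdl t)"
      by simp
  qed
  with s that show thesis by blast
qed

end

theorem theorem3p4:
  fixes R :: "('a, 'm) ring_scheme" and n :: nat
  assumes "cring R"
    and "finite (carrier R)"
    and "\<one>\<^bsub>R\<^esub> \<noteq> \<zero>\<^bsub>R\<^esub>"
    and "\<not> field R"
    and "n > 1"
  shows "int (domination_number (TD R n))
           \<le> int (card (carrier R - Units R)) + int (card (carrier R)) - 2"
proof -
  interpret cring R by fact
  obtain s where s: "s \<in> carrier R" "s \<noteq> \<zero>\<^bsub>R\<^esub>" "s \<notin> Units R"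
    and minimal: "\<And>t. t \<in> PIdl\<^bsub>R\<^esub> s \<Longrightarrow> t \<noteq> \<zero>\<^bsub>R\<^esub> \<Longrightarrow> PIdl\<^bsub>R\<^esub> t = PIdl\<^bsub>R\<^esub> s"
    using exists_nonunit_generating_minimal_ideal assms(2-4) by blast
  let ?L = "(\<lambda>t. two_coordinate_vector R n t s) ` (PIdl\<^bsub>R\<^esub> s)"
  let ?D = "insert (two_coordinate_vector R n s \<zero>\<^bsub>R\<^esub>) ?L"
  have "\<one>\<^bsub>R\<^esub> \<notin> PIdl\<^bsub>R\<^esub> s"
    using s by (auto simp: cgenideal_def Units_def m_comm)
  then have proper: "PIdl\<^bsub>R\<^esub> s \<subset> carrier R"
    using s(1) by (auto simp: cgenideal_def)
  have fin: "finite (PIdl\<^bsub>R\<^esub> s)"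
    using proper assms(2) finite_subset by blast
  have "domination_number (TD R n) \<le> card ?D"
    using fin dominating_minimal_ideal[OF assms(5) s(1,2) minimal]
    by (intro domination_number_le_card) auto
  also have "card ?D \<le> Suc (card ?L)"
    by (rule card_insert_le_m1) auto
  also have "\<dots> \<le> Suc (card (PIdl\<^bsub>R\<^esub> s))"
    using card_image_le[OF fin] by simp
  also have "\<dots> \<le> card (carrier R)"
    using psubset_card_mono[OF assms(2) proper] by simp
  finally have bound: "domination_number (TD R n) \<le> card (carrier R)" .
  have "{\<zero>\<^bsub>R\<^esub>, s} \<subseteq> carrier R - Units R"
    using s assms(3) by (auto simp: Units_def)
  then have "2 \<le> card (carrier R - Units R)"
    using card_mono[of "carrier R - Units R" "{\<zero>\<^bsub>R\<^esub>, s}"] assms(2) s(2) by simp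
  with bound show ?thesis by linarith
qed

end
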